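(* Let $S$ be a convex subset of a real vector space such that $\operatorname{icr} S\neq\emptyset$ and let $\varphi:S\to\mathbb{R}$ be a convex function. Let $x_0\in\operatorname{icr}S$, let $A\ge\varphi(x_0)$ be a real number, and let $$S_A:=\{x\in S:\varphi(x)\le A\},$$ $$C_A:=\{x\in S_A:\text{ there exists }\alpha>0\text{ such that }x_0+\alpha(x-x_0)\in S_A\text{ and }x_0-\alpha(x-x_0)\in S_A\},$$ where $x_0$ is such that $C_A-x_0=-(C_A-x_0)$. Let $\mu$ be the Minkowski functional of the set $C_A-x_0$. Then $\varphi$ is locally $\mu$-Lipschitz on $\operatorname{icr}S$.
   Context: The relative algebraic interior of $S$ is $\operatorname{icr}S=\{x\in S:\text{ for every }y\in\operatorname{span}(S-S)\text{ there is }t>0\text{ with }x+ty\in S\}$, where $S-S=\{a-b:a,b\in S\}$. The Minkowski functional of a set $D$ is $\mu_D(x)=\inf\{t>0:x\in tD\}$, with $\inf\emptyset=+\infty$. A function $\varphi$ is $\mu$-Lipschitz on a set $D$ if there is $L>0$ with $|\varphi(x)-\varphi(y)|\le L\mu(x-y)$ for all $x,y\in D$. Here, $\varphi$ is locally $\mu$-Lipschitz on $\operatorname{icr}S$ if for every $x\in\operatorname{icr}S$ there exists $\varepsilon>0$ such that $\varepsilon(C_A-x_0)+x\subset S$ and $\varphi$ is $\mu$-Lipschitz on $\varepsilon(C_A-x_0)+x$. *)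

theory Defs
  imports "HOL-Analysis.Convex" "HOL-Library.Extended_Real"
begin

text \<open>Relative algebraic interior of a set in a real vector space without topology.\<close>

definition icr :: "'a::real_vector set \<Rightarrow> 'a set" where
  "icr S = {x \<in> S. \<forall>y \<in> span {a - b | a b. a \<in> S \<and> b \<in> S}. \<exists>t>0. x + t *\<^sub>R y \<in> S}"

text \<open>The infimum is taken in \<^typ>\<open>ereal\<close>, so that it equals \<open>\<infinity>\<close> where no positive multiple of
  \<open>D\<close> contains \<open>x\<close>.\<close>

definition minkowski_functional :: "'a::real_vector set \<Rightarrow> 'a \<Rightarrow> ereal" where
  "minkowski_functional D x = Inf (ereal ` {t. t > 0 \<and> x \<in> (\<lambda>d. t *\<^sub>R d) ` D})"

definition lipschitz_wrt :: "('a::real_vector \<Rightarrow> ereal) \<Rightarrow> 'a set \<Rightarrow> ('a \<Rightarrow> real) \<Rightarrow> bool" where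
  "lipschitz_wrt \<mu> D \<phi> \<longleftrightarrow>
     (\<exists>L::real. L > 0 \<and> (\<forall>x\<in>D. \<forall>y\<in>D. ereal \<bar>\<phi> x - \<phi> y\<bar> \<le> ereal L * \<mu> (x - y)))"

text \<open>The sets \<open>\<epsilon> D + x\<close> play the role of neighbourhoods of \<open>x\<close>; \<open>S\<close> is the domain of \<open>\<phi>\<close>.\<close>

definition locally_lipschitz_wrt ::
  "('a::real_vector \<Rightarrow> ereal) \<Rightarrow> 'a set \<Rightarrow> 'a set \<Rightarrow> 'a set \<Rightarrow> ('a \<Rightarrow> real) \<Rightarrow> bool" where
  "locally_lipschitz_wrt \<mu> D S T \<phi> \<longleftrightarrow>
     (\<forall>x\<in>T. \<exists>\<epsilon>>0. (\<lambda>d. \<epsilon> *\<^sub>R d + x) ` D \<subseteq> S \<and>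
        lipschitz_wrt \<mu> ((\<lambda>d. \<epsilon> *\<^sub>R d + x) ` D) \<phi>)"

definition sublevel :: "'a set \<Rightarrow> ('a \<Rightarrow> real) \<Rightarrow> real \<Rightarrow> 'a set" where
  "sublevel S \<phi> A = {x \<in> S. \<phi> x \<le> A}"

definition sublevel_core ::
  "'a::real_vector set \<Rightarrow> ('a \<Rightarrow> real) \<Rightarrow> real \<Rightarrow> 'a \<Rightarrow> 'a set" where
  "sublevel_core S \<phi> A x0 = {x \<in> sublevel S \<phi> A. \<exists>\<alpha>>0.
     x0 + \<alpha> *\<^sub>R (x - x0) \<in> sublevel S \<phi> A \<and> x0 - \<alpha> *\<^sub>R (x - x0) \<in> sublevel S \<phi> A}"

end

theory Submission
  imports Defs
begin

text \<open>If \<open>x \<in> icr S\<close> then \<open>x\<close> lies strictly between \<open>x0\<close> and some \<open>z \<in> S\<close>, so the homothety with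
  centre \<open>z\<close> maps the set \<open>D + x0\<close>, on which \<open>\<phi> \<le> A\<close>, to a set \<open>r D + x\<close> contained in \<open>S\<close>, and
  convexity bounds \<open>\<phi>\<close> from above there. Symmetry of \<open>D\<close> then yields a lower bound, and a convex
  function bounded on \<open>r D + x\<close> is \<open>\<mu>\<close>-Lipschitz on \<open>(r / 2) D + x\<close>: prolong a segment from \<open>v\<close> to
  \<open>u\<close> beyond \<open>u\<close> by a vector of \<open>(r / 2) D\<close> and use monotonicity of difference quotients.\<close>

text \<open>Dividing by \<open>L\<close> turns the claim into a lower bound for an infimum in
  \<open>ereal\<close>. This includes the infimum of the empty set, which is infinite.\<close>

lemma le_mult_minkowski_functional:
  assumes "L > 0"
    and "\<And>t d. t > 0 \<Longrightarrow> d \<in> D \<Longrightarrow> x = t *\<^sub>R d \<Longrightarrow> a \<le> L * t"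
  shows "ereal a \<le> ereal L * minkowski_functional D x"
proof -
  have "ereal (a / L) \<le> minkowski_functional D x"
    unfolding minkowski_functional_def
  proof (rule Inf_greatest)
    fix e assume "e \<in> ereal ` {t. t > 0 \<and> x \<in> (\<lambda>d. t *\<^sub>R d) ` D}"
    then show "ereal (a / L) \<le> e"
      using assms by (auto simp: divide_simps mult.commute)
  qed
  then have "ereal L * ereal (a / L) \<le> ereal L * minkowski_functional D x"
    using \<open>L > 0\<close> by (intro ereal_mult_left_mono) auto
  then show ?thesis
    using \<open>L > 0\<close> by simp
qed

lemma convex_sublevel:
  assumes "convex_on S \<phi>"
  shows "convex (sublevel S \<phi> A)"
proof (rule convexI)
  fix x y and u v :: real
  assume xy: "x \<in> sublevel S \<phi> A" "y \<in> sublevel S \<phi> A" and uv: "0 \<le> u" "0 \<le> v" "u + v = 1"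
  then have "u *\<^sub>R x + v *\<^sub>R y \<in> S"
    using convex_on_imp_convex[OF assms] by (auto simp: sublevel_def intro: convexD)
  moreover have "\<phi> (u *\<^sub>R x + v *\<^sub>R y) \<le> u * \<phi> x + v * \<phi> y"
    using assms xy uv by (auto simp: convex_on_def sublevel_def)
  moreover have "u * \<phi> x + v * \<phi> y \<le> A"
    using xy uv by (intro convex_bound_le) (auto simp: sublevel_def)
  ultimately show "u *\<^sub>R x + v *\<^sub>R y \<in> sublevel S \<phi> A"
    by (simp add: sublevel_def)
qed

text \<open>Since \<open>?S\<close> is convex and contains \<open>x0\<close>, two witnesses can be
  lowered to their minimum. With a common witness, both membership conditions pass to convex
  combinations.\<close>

lemma convex_sublevel_core:
  assumes "convex_on S \<phi>" and x0: "x0 \<in> sublevel S \<phi> A"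
  shows "convex (sublevel_core S \<phi> A x0)"
proof (rule convexI)
  let ?S = "sublevel S \<phi> A"
  note cv = convex_sublevel[OF assms(1), of A]
  have shrink: "x0 + b *\<^sub>R w \<in> ?S" if "x0 + a *\<^sub>R w \<in> ?S" "0 < b" "b \<le> a" for a b :: real and w
  proof -
    have "(1 - b / a) *\<^sub>R x0 + (b / a) *\<^sub>R (x0 + a *\<^sub>R w) \<in> ?S"
      using that x0 by (intro convexD[OF cv]) auto
    then show ?thesis
      using that by (simp add: algebra_simps)
  qed
  fix x y and u v :: real
  assume x: "x \<in> sublevel_core S \<phi> A x0" and y: "y \<in> sublevel_core S \<phi> A x0"
    and uv: "0 \<le> u" "0 \<le> v" "u + v = 1"
  \<comment> \<open>Both directions are put in the form \<open>x0\<close> plus a multiple of a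
    vector, so that \<open>shrink\<close> applies to each.\<close>
  obtain a where a: "a > 0" "x0 + a *\<^sub>R (x - x0) \<in> ?S" "x0 + a *\<^sub>R (- (x - x0)) \<in> ?S"
    using x by (auto simp: sublevel_core_def simp del: minus_diff_eq)
  obtain b where b: "b > 0" "x0 + b *\<^sub>R (y - x0) \<in> ?S" "x0 + b *\<^sub>R (- (y - x0)) \<in> ?S"
    using y by (auto simp: sublevel_core_def simp del: minus_diff_eq)
  define c where "c = min a b"
  have c: "0 < c" "c \<le> a" "c \<le> b"
    using a(1) b(1) by (auto simp: c_def)
  have u: "u = 1 - v"
    using uv by simp
  have "u *\<^sub>R (x0 + c *\<^sub>R (x - x0)) + v *\<^sub>R (x0 + c *\<^sub>R (y - x0)) \<in> ?S"
    by (rule convexD[OF cv shrink[OF a(2) c(1,2)] shrink[OF b(2) c(1,3)] uv])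
  moreover have "u *\<^sub>R (x0 + c *\<^sub>R (- (x - x0))) + v *\<^sub>R (x0 + c *\<^sub>R (- (y - x0))) \<in> ?S"
    by (rule convexD[OF cv shrink[OF a(3) c(1,2)] shrink[OF b(3) c(1,3)] uv])
  moreover have "u *\<^sub>R x + v *\<^sub>R y \<in> ?S"
    using x y uv by (intro convexD[OF cv]) (auto simp: sublevel_core_def)
  ultimately show "u *\<^sub>R x + v *\<^sub>R y \<in> sublevel_core S \<phi> A x0"
    using c(1) unfolding sublevel_core_def u
    by (auto intro!: exI[of _ c] simp: algebra_simps)
qed

lemma lipschitz_wrt_minkowski_functional:
  assumes \<phi>: "convex_on S \<phi>" and D: "convex D" "\<And>d. d \<in> D \<Longrightarrow> - d \<in> D" and "r > 0"
    and S: "\<And>d. d \<in> D \<Longrightarrow> r *\<^sub>R d + x \<in> S"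
    and M: "\<And>d. d \<in> D \<Longrightarrow> \<phi> (r *\<^sub>R d + x) \<le> M"
  shows "lipschitz_wrt (minkowski_functional D) ((\<lambda>d. (r / 2) *\<^sub>R d + x) ` D) \<phi>"
proof -
  \<comment> \<open>\<open>N\<close> bounds the oscillation: the values will lie between
    \<open>2 * \<phi> x - M\<close> and \<open>M\<close>. The absolute value and the added 1 make
    \<open>N\<close> positive whatever the sign of \<open>M - \<phi> x\<close>.\<close>
  define N where "N = 2 * \<bar>M - \<phi> x\<bar> + 1"
  define L where "L = 2 * N / r"
  have "N > 0"
    by (simp add: N_def add_nonneg_pos)
  then have "L > 0"
    using \<open>r > 0\<close> by (simp add: L_def)
  have comb: "\<phi> (a *\<^sub>R y + b *\<^sub>R z) \<le> a * \<phi> y + b * \<phi> z"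
    if "y \<in> S" "z \<in> S" "0 \<le> a" "0 \<le> b" "a + b = 1" for y z a b
    using \<phi> that unfolding convex_on_def by blast
  \<comment> \<open>\<open>x\<close> is the midpoint of this point and its reflection in
    \<open>x\<close>, where \<phi> is at most \<open>M\<close>.\<close>
  have lower: "2 * \<phi> x - M \<le> \<phi> (r *\<^sub>R d + x)" if d: "d \<in> D" for d
  proof -
    have "\<phi> ((1/2) *\<^sub>R (r *\<^sub>R d + x) + (1/2) *\<^sub>R (r *\<^sub>R (- d) + x))
        \<le> 1/2 * \<phi> (r *\<^sub>R d + x) + 1/2 * \<phi> (r *\<^sub>R (- d) + x)"
      by (rule comb[OF S[OF d] S[OF D(2)[OF d]]]) auto
    moreover have "(1/2) *\<^sub>R (r *\<^sub>R d + x) + (1/2) *\<^sub>R (r *\<^sub>R (- d) + x) = x"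
      by (simp add: algebra_simps flip: scaleR_add_left)
    ultimately show ?thesis
      using M[OF D(2)[OF d]] by simp
  qed
  have mid: "(1/2) *\<^sub>R d + (1/2) *\<^sub>R d' \<in> D" if "d \<in> D" "d' \<in> D" for d d'
    using D(1) that by (rule convexD) auto
  have one_sided: "\<phi> u - \<phi> v \<le> L * t"
    if u: "u = (r/2) *\<^sub>R d + x" "d \<in> D" and v: "v = (r/2) *\<^sub>R e + x" "e \<in> D"
      and uv: "u - v = t *\<^sub>R f" "f \<in> D" "t > 0" for u v d e f t
  proof -
    \<comment> \<open>With this \<open>s\<close>, prolonging by \<open>s\<close> times
      \<open>u - v\<close> adds exactly half of \<open>r\<close> times \<open>f\<close>, so
      \<open>w\<close> comes from the midpoint of \<open>d\<close> and \<open>f\<close> and stays in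
      the set of radius \<open>r\<close>.\<close>
    define s where "s = r / (2 * t)"
    have "s > 0"
      using \<open>r > 0\<close> uv(3) by (simp add: s_def)
    define w where "w = u + s *\<^sub>R (u - v)"
    have "s * t = r / 2"
      using uv(3) by (simp add: s_def)
    then have "w = r *\<^sub>R ((1/2) *\<^sub>R d + (1/2) *\<^sub>R f) + x"
      unfolding w_def uv(1) by (simp add: u(1) scaleR_add_right add_ac)
    then have w: "w \<in> S" "\<phi> w \<le> M"
      using S M mid[OF u(2) uv(2)] by auto
    \<comment> \<open>The origin is the midpoint of \<open>e\<close> and \<open>- e\<close>; half of
      \<open>e\<close> is then in \<open>D\<close>, which places \<open>v\<close> in the set of
      radius \<open>r\<close>.\<close>
    have zero: "0 \<in> D"
      using mid[OF v(2) D(2)[OF v(2)]] by simp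
    have "v = r *\<^sub>R ((1/2) *\<^sub>R e + (1/2) *\<^sub>R 0) + x"
      using v(1) by simp
    then have v': "v \<in> S" "2 * \<phi> x - M \<le> \<phi> v"
      using S[OF mid[OF v(2) zero]] lower[OF mid[OF v(2) zero]] by simp_all
    have "u = (1 / (1 + s)) *\<^sub>R w + (s / (1 + s)) *\<^sub>R v"
    proof -
      have "(1 + s) *\<^sub>R u = w + s *\<^sub>R v"
        by (simp add: w_def algebra_simps)
      then have "(1 / (1 + s)) *\<^sub>R ((1 + s) *\<^sub>R u) = (1 / (1 + s)) *\<^sub>R (w + s *\<^sub>R v)"
        by simp
      then show ?thesis
        using \<open>s > 0\<close> by (simp add: scaleR_add_right)
    qed
    moreover have coeff: "s / (1 + s) = 1 - 1 / (1 + s)"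
      using \<open>s > 0\<close> by (simp add: field_simps)
    ultimately have "\<phi> u \<le> 1 / (1 + s) * \<phi> w + s / (1 + s) * \<phi> v"
      using comb[OF w(1) v'(1), of "1 / (1 + s)" "s / (1 + s)"] \<open>s > 0\<close> by simp
    then have "\<phi> u - \<phi> v \<le> (\<phi> w - \<phi> v) / (1 + s)"
      unfolding coeff by (simp add: algebra_simps diff_divide_distrib)
    also have "\<dots> \<le> N / (1 + s)"
      using w v' \<open>s > 0\<close> by (intro divide_right_mono) (use abs_ge_self[of "M - \<phi> x"] in \<open>auto simp: N_def\<close>)
    \<comment> \<open>Dropping the 1 makes the bound proportional to \<open>t\<close>, because
      \<open>1 / s = 2 * t / r\<close>.\<close>
    also have "\<dots> \<le> N / s"
      using \<open>s > 0\<close> \<open>N > 0\<close> by (intro divide_left_mono) auto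
    also have "\<dots> = L * t"
      by (simp add: s_def L_def)
    finally show ?thesis .
  qed
  show ?thesis
    unfolding lipschitz_wrt_def
  proof (intro exI[of _ L] conjI ballI \<open>L > 0\<close>)
    fix u v
    assume "u \<in> (\<lambda>d. (r/2) *\<^sub>R d + x) ` D" "v \<in> (\<lambda>d. (r/2) *\<^sub>R d + x) ` D"
    then obtain d e where u: "u = (r/2) *\<^sub>R d + x" "d \<in> D" and v: "v = (r/2) *\<^sub>R e + x" "e \<in> D"
      by auto
    show "ereal \<bar>\<phi> u - \<phi> v\<bar> \<le> ereal L * minkowski_functional D (u - v)"
    proof (rule le_mult_minkowski_functional[OF \<open>L > 0\<close>])
      fix t f assume t: "t > 0" "f \<in> D" "u - v = t *\<^sub>R f"
      \<comment> \<open>Exchanging \<open>u\<close> and \<open>v\<close> keeps \<open>t\<close> and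
        replaces \<open>f\<close> by \<open>- f\<close>, again in \<open>D\<close>.\<close>
      then have "v - u = t *\<^sub>R (- f)"
        by (simp add: algebra_simps)
      then show "\<bar>\<phi> u - \<phi> v\<bar> \<le> L * t"
        using one_sided[OF u v t(3,2,1)] one_sided[OF v u _ D(2)[OF t(2)] t(1)] by simp
    qed
  qed
qed

text \<open>The direction \<open>x - y\<close> is itself a difference of two points of
  \<open>S\<close>, so the definition of \<open>icr\<close> applies to it.\<close>

lemma icr_extend_beyond:
  assumes "x \<in> icr S" "y \<in> S"
  obtains t where "t > 0" "x + t *\<^sub>R (x - y) \<in> S"
proof -
  have "x - y \<in> span {a - b | a b. a \<in> S \<and> b \<in> S}"
    using assms by (intro span_base) (auto simp: icr_def)
  then show thesis
    using assms(1) that by (auto simp: icr_def)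
qed

theorem corollary2p2p1:
  fixes S :: "'a::real_vector set" and \<phi> :: "'a \<Rightarrow> real" and x0 :: 'a and A :: real
    and D :: "'a set" and \<mu> :: "'a \<Rightarrow> ereal"
  assumes "convex S"
    and "icr S \<noteq> {}"
    and "convex_on S \<phi>"
    and "x0 \<in> icr S"
    and "A \<ge> \<phi> x0"
    and D_def: "D = (\<lambda>x. x - x0) ` sublevel_core S \<phi> A x0"
    and "D = uminus ` D"
    and \<mu>_def: "\<mu> = minkowski_functional D"
  shows "locally_lipschitz_wrt \<mu> D S (icr S) \<phi>"
  unfolding locally_lipschitz_wrt_def
proof
  fix x assume "x \<in> icr S"
  have x0: "x0 \<in> S" "x0 \<in> sublevel S \<phi> A"
    using assms(4,5) by (auto simp: icr_def sublevel_def)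
  have "convex D"
    unfolding D_def using convex_sublevel_core[OF assms(3) x0(2)] by (simp add: convex_translation_subtract)
  have sym: "- d \<in> D" if "d \<in> D" for d
    using assms(7) that by (metis imageI)
  have D: "x0 + d \<in> S" "\<phi> (x0 + d) \<le> A" if "d \<in> D" for d
    using that by (auto simp: D_def sublevel_core_def sublevel_def)
  obtain t where "t > 0" and z: "x + t *\<^sub>R (x - x0) \<in> S"
    using icr_extend_beyond[OF \<open>x \<in> icr S\<close> x0(1)] .
  define z where "z = x + t *\<^sub>R (x - x0)"
  \<comment> \<open>\<open>r\<close> is the weight of \<open>x0\<close> when \<open>x\<close> is
    written as a convex combination of \<open>z\<close> and \<open>x0\<close>, hence the ratio of
    the homothety centred at \<open>z\<close> that takes \<open>x0\<close> to
    \<open>x\<close>.\<close>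
  define r where "r = t / (1 + t)"
  have r: "0 < r" "r < 1"
    using \<open>t > 0\<close> by (auto simp: r_def)
  have "(1 + t) *\<^sub>R ((1 - r) *\<^sub>R z + r *\<^sub>R x0) = (1 + t) *\<^sub>R x"
  proof -
    have "(1 + t) * (1 - r) = 1" "(1 + t) * r = t"
      using \<open>t > 0\<close> by (auto simp: r_def field_simps)
    then have "(1 + t) *\<^sub>R ((1 - r) *\<^sub>R z + r *\<^sub>R x0) = z + t *\<^sub>R x0"
      by (simp add: scaleR_add_right)
    then show ?thesis
      by (simp add: z_def algebra_simps)
  qed
  then have "x = (1 - r) *\<^sub>R z + r *\<^sub>R x0"
    using \<open>t > 0\<close> by simp
  then have eq: "r *\<^sub>R d + x = (1 - r) *\<^sub>R z + r *\<^sub>R (x0 + d)" for d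
    by (simp add: scaleR_add_right)
  have S: "r *\<^sub>R d + x \<in> S" if "d \<in> D" for d
    unfolding eq using r D[OF that] z by (intro convexD[OF assms(1)]) (auto simp: z_def)
  \<comment> \<open>The right-hand side does not depend on \<open>d\<close>, so it can serve as the
    uniform upper bound.\<close>
  have M: "\<phi> (r *\<^sub>R d + x) \<le> (1 - r) * \<phi> z + r * A" if "d \<in> D" for d
  proof -
    have "\<phi> (r *\<^sub>R d + x) \<le> (1 - r) * \<phi> z + r * \<phi> (x0 + d)"
      unfolding eq using assms(3) r D(1)[OF that] z by (auto simp: convex_on_def z_def)
    also have "\<dots> \<le> (1 - r) * \<phi> z + r * A"
      using r D(2)[OF that] by simp
    finally show ?thesis .
  qed
  \<comment> \<open>Halving the radius gives midpoints of \<open>x\<close> and points already known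
    to lie in \<open>S\<close>.\<close>
  have "(r / 2) *\<^sub>R d + x \<in> S" if "d \<in> D" for d
  proof -
    have "(1/2) *\<^sub>R (r *\<^sub>R d + x) + (1/2) *\<^sub>R x \<in> S"
      using S[OF that] \<open>x \<in> icr S\<close> by (intro convexD[OF assms(1)]) (auto simp: icr_def)
    then show ?thesis
      by (simp add: scaleR_add_right add.assoc flip: scaleR_add_left)
  qed
  then show "\<exists>\<epsilon>>0. (\<lambda>d. \<epsilon> *\<^sub>R d + x) ` D \<subseteq> S \<and> lipschitz_wrt \<mu> ((\<lambda>d. \<epsilon> *\<^sub>R d + x) ` D) \<phi>"
    unfolding \<mu>_def using r(1) lipschitz_wrt_minkowski_functional[OF assms(3) \<open>convex D\<close> sym r(1) S M]
    by (intro exI[of _ "r / 2"]) auto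
qed

end
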